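(* Let $\boldsymbol{X}=(X_1,\dots,X_d)$ follow the multivariate thinning-dependence Poisson distribution with background Poisson random variables $Y_1,\dots,Y_l$ of rates $\theta_1,\dots,\theta_l$ and thinning probabilities $p_j^k$, $j=1,\dots,d$, $k=1,\dots,l$, and let $i\in\{1,\dots,d\}$. Then for every $x\in\mathbb N=\{0,1,2,\dots\}$, as $p_i^k\to0$ for all $k=1,\dots,l$ (all other parameters fixed), $$F_{M^{\boldsymbol X}}(x)\sim F_{M_{-i}^{\boldsymbol X}}(x),\qquad F_{m^{\boldsymbol X}}(x)\sim1.$$
   Context: Multivariate thinning-dependence Poisson distribution: let $Y_1,\dots,Y_l$ be independent Poisson random variables with rates $\theta_1,\dots,\theta_l>0$, let $p_j^k\in[0,1]$ for $j=1,\dots,d$, $k=1,\dots,l$, and let $\boldsymbol X=(X_1,\dots,X_d)$ with $X_j=\sum_{k=1}^{l}X_j^k$. The vector $\boldsymbol X$ follows the multivariate thinning-dependence Poisson distribution if: (i) conditionally on $Y_k=y_k$, $X_j^k$ is binomial with parameters $y_k$ and $p_j^k$, i.e. $\mathbb P(X_j^k=z\mid Y_k=y_k)=\binom{y_k}{z}(p_j^k)^z(1-p_j^k)^{y_k-z}$ for $0\le z\le y_k$; (ii) for each $k$, $X_1^k,\dots,X_d^k$ are conditionally independent given $Y_k=y_k$; (iii) the $l$ random vectors $(Y_1,X_1^1,\dots,X_d^1),\dots,(Y_l,X_1^l,\dots,X_d^l)$ are independent. $M^{\boldsymbol X}=\max(X_1,\dots,X_d)$, $m^{\boldsymbol X}=\min(X_1,\dots,X_d)$,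 and $M_{-i}^{\boldsymbol X}$ is the maximum of the components $X_j$ with $j\ne i$. $F_W$ denotes the cumulative distribution function of a random variable $W$. The notation $f\sim g$ in a limit of the parameters means that the ratio $f/g$ tends to $1$ in that limit. *)

theory Defs
  imports "HOL-Probability.Probability" "HOL-Library.Landau_Symbols"
begin

text \<open>
  \<open>Z j k\<close> is $X_j^k$ and \<open>p j k\<close> is $p_j^k$. Components are indexed by \<open>{1..d}\<close> and background
  variables by \<open>{1..l}\<close>; values at other indices are irrelevant.
\<close>

locale thinning_dependence_poisson = prob_space M
  for M :: "'a measure" +
  fixes d l :: nat
    and \<theta> :: "nat \<Rightarrow> real"
    and p :: "nat \<Rightarrow> nat \<Rightarrow> real"
    and Y :: "nat \<Rightarrow> 'a \<Rightarrow> nat"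
    and Z :: "nat \<Rightarrow> nat \<Rightarrow> 'a \<Rightarrow> nat"
    and X :: "nat \<Rightarrow> 'a \<Rightarrow> nat"
  assumes rate_pos: "k \<in> {1..l} \<Longrightarrow> \<theta> k > 0"
    and thinning_prob: "j \<in> {1..d} \<Longrightarrow> k \<in> {1..l} \<Longrightarrow> p j k \<in> {0..1}"
    and measurable_Y: "k \<in> {1..l} \<Longrightarrow> Y k \<in> measurable M (count_space UNIV)"
    and measurable_Z:
      "j \<in> {1..d} \<Longrightarrow> k \<in> {1..l} \<Longrightarrow> Z j k \<in> measurable M (count_space UNIV)"
    and poisson_Y:
      "k \<in> {1..l} \<Longrightarrow> distr M (count_space UNIV) (Y k) = measure_pmf (poisson_pmf (\<theta> k))"
    and indep_Y: "indep_vars (\<lambda>_. count_space UNIV) Y {1..l}"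
    and X_eq: "j \<in> {1..d} \<Longrightarrow> \<omega> \<in> space M \<Longrightarrow> X j \<omega> = (\<Sum>k=1..l. Z j k \<omega>)"
    and binomial_thinning:
      "j \<in> {1..d} \<Longrightarrow> k \<in> {1..l} \<Longrightarrow> z \<le> y \<Longrightarrow>
        \<P>(\<omega> in M. Z j k \<omega> = z \<bar> Y k \<omega> = y)
          = real (y choose z) * p j k ^ z * (1 - p j k) ^ (y - z)"
    \<comment> \<open>\<open>uniform_measure M {\<omega> \<in> space M. Y k \<omega> = y}\<close> is the conditional probability measure given
      \<open>Y k = y\<close>, an event of positive probability.\<close>
    and cond_indep_thinning:
      "k \<in> {1..l} \<Longrightarrow>
        prob_space.indep_vars (uniform_measure M {\<omega> \<in> space M. Y k \<omega> = y})
          (\<lambda>_. count_space UNIV) (\<lambda>j. Z j k) {1..d}"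
    and indep_blocks:
      "indep_vars (\<lambda>_. count_space UNIV \<Otimes>\<^sub>M (\<Pi>\<^sub>M j\<in>{1..d}. count_space UNIV))
        (\<lambda>k \<omega>. (Y k \<omega>, \<lambda>j\<in>{1..d}. Z j k \<omega>)) {1..l}"

definition max_comp :: "nat \<Rightarrow> (nat \<Rightarrow> 'a \<Rightarrow> nat) \<Rightarrow> 'a \<Rightarrow> nat" where
  "max_comp d X \<omega> = Max ((\<lambda>j. X j \<omega>) ` {1..d})"

definition min_comp :: "nat \<Rightarrow> (nat \<Rightarrow> 'a \<Rightarrow> nat) \<Rightarrow> 'a \<Rightarrow> nat" where
  "min_comp d X \<omega> = Min ((\<lambda>j. X j \<omega>) ` {1..d})"

text \<open>
  For \<open>d \<ge> 2\<close> the supremum is the maximum; for \<open>d = 1\<close> there is no other component and the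
  supremum of the empty set of natural numbers is \<open>0\<close>.
\<close>

definition max_comp_except :: "nat \<Rightarrow> nat \<Rightarrow> (nat \<Rightarrow> 'a \<Rightarrow> nat) \<Rightarrow> 'a \<Rightarrow> nat" where
  "max_comp_except d i X \<omega> = (SUP j\<in>{1..d} - {i}. X j \<omega>)"

definition cdf_of :: "'a measure \<Rightarrow> ('a \<Rightarrow> nat) \<Rightarrow> real \<Rightarrow> real" where
  "cdf_of M W = cdf (distr M borel (\<lambda>\<omega>. real (W \<omega>)))"

end

theory Submission
  imports Defs
begin

text \<open>
  The two distribution functions of the maxima differ by at most
  $P(X_i \neq 0) \le \sum_k (1 - e^{-\theta_k p_i^k}) \to 0$, since a Poisson variable thinned with
  probability $p$ vanishes with probability $e^{-\theta p}$. Moreover $F_{M_{-i}}(x)$ stays above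
  $P(Y_1 = \dots = Y_l = 0) = e^{-(\theta_1 + \dots + \theta_l)} > 0$, so the ratio tends to $1$.
  Finally $F_m(x) \ge P(X_i = 0) \to 1$.
\<close>

section \<open>Distribution functions and order characterizations of maximum and minimum\<close>

lemma (in prob_space) cdf_of_eq_prob:
  fixes W :: "'a \<Rightarrow> nat"
  assumes W: "\<And>y. {\<omega> \<in> space M. W \<omega> \<le> y} \<in> events"
  shows "cdf_of M W (real x) = prob {\<omega> \<in> space M. W \<omega> \<le> x}"
proof -
  have "(\<lambda>\<omega>. real (W \<omega>)) \<in> borel_measurable M"
  \<comment> \<open>Measurability is assumed only through level sets at natural thresholds. A
    nonnegative real threshold can be rounded down because \<open>W\<close> takes natural values; a
    negative one gives the empty event.\<close>
  proof (rule borel_measurable_iff_le[THEN iffD2], rule allI)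
    fix a :: real
    have "{\<omega> \<in> space M. real (W \<omega>) \<le> a} = (if a < 0 then {} else {\<omega> \<in> space M. W \<omega> \<le> nat \<lfloor>a\<rfloor>})"
      by (auto simp: le_nat_floor) linarith
    then show "{\<omega> \<in> space M. real (W \<omega>) \<le> a} \<in> events"
      using W by simp
  qed
  then show ?thesis
    by (simp add: cdf_of_def cdf_def measure_distr vimage_def Int_def conj_commute)
qed

lemma max_comp_le_iff:
  assumes "d \<ge> 1"
  shows "max_comp d X \<omega> \<le> x \<longleftrightarrow> (\<forall>j\<in>{1..d}. X j \<omega> \<le> x)"
  using assms by (auto simp: max_comp_def)

lemma min_comp_le_iff:
  assumes "d \<ge> 1"
  shows "min_comp d X \<omega> \<le> x \<longleftrightarrow> (\<exists>j\<in>{1..d}. X j \<omega> \<le> x)"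
  using assms by (auto simp: min_comp_def Min_le_iff)

text \<open>The empty index set, which occurs for \<open>d = 1\<close> and \<open>i = 1\<close>,
  fits in: the supremum is then 0, so both sides are true. Otherwise the supremum is a finite
  maximum.\<close>

lemma max_comp_except_le_iff:
  "max_comp_except d i X \<omega> \<le> x \<longleftrightarrow> (\<forall>j\<in>{1..d} - {i}. X j \<omega> \<le> x)"
proof (cases "{1..d} - {i} = {}")
  case False
  then have "max_comp_except d i X \<omega> = Max ((\<lambda>j. X j \<omega>) ` ({1..d} - {i}))"
    unfolding max_comp_except_def by (simp add: Sup_nat_def del: Diff_eq_empty_iff)
  with False show ?thesis
    by (simp only: Max_le_iff finite_imageI finite_Diff finite_atLeastAtMost image_is_empty
        not_False_eq_True) blast
next
  case True
  show ?thesis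
    unfolding max_comp_except_def True by (simp add: Sup_nat_def)
qed

section \<open>Measurability of the events in the model\<close>

context thinning_dependence_poisson
begin

lemma events_Y_eq: "k \<in> {1..l} \<Longrightarrow> {\<omega> \<in> space M. Y k \<omega> = y} \<in> events"
  using measurable_sets[OF measurable_Y, of k "{y}"] by (simp add: vimage_def Int_def conj_commute)

lemma events_Z_eq:
  "j \<in> {1..d} \<Longrightarrow> k \<in> {1..l} \<Longrightarrow> {\<omega> \<in> space M. Z j k \<omega> = z} \<in> events"
  using measurable_sets[OF measurable_Z, of j k "{z}"] by (simp add: vimage_def Int_def conj_commute)

lemma measurable_X:
  assumes j: "j \<in> {1..d}"
  shows "X j \<in> measurable M (count_space UNIV)"
proof -
  have "(\<lambda>\<omega>. \<Sum>k=1..l. Z j k \<omega>) \<in> measurable M (count_space UNIV)"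
    using measurable_Z[OF j] by measurable
  then show ?thesis
    by (subst measurable_cong[OF X_eq[OF j]])
qed

lemma events_X_le: "j \<in> {1..d} \<Longrightarrow> {\<omega> \<in> space M. X j \<omega> \<le> x} \<in> events"
  using measurable_sets[OF measurable_X, of j "{..x}"]
  by (simp add: vimage_def Int_def conj_commute)

lemma events_all_X_le: "J \<subseteq> {1..d} \<Longrightarrow> {\<omega> \<in> space M. \<forall>j\<in>J. X j \<omega> \<le> x} \<in> events"
  using events_X_le by (intro sets.sets_Collect_finite_All) (auto intro: finite_subset)

lemma events_ex_X_le: "J \<subseteq> {1..d} \<Longrightarrow> {\<omega> \<in> space M. \<exists>j\<in>J. X j \<omega> \<le> x} \<in> events"
  using events_X_le by (intro sets.sets_Collect_finite_Ex) (auto intro: finite_subset)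

section \<open>Probability that a thinned variable or a component vanishes\<close>

lemma prob_Y_eq:
  assumes k: "k \<in> {1..l}"
  shows "prob {\<omega> \<in> space M. Y k \<omega> = y} = \<theta> k ^ y / fact y * exp (- \<theta> k)"
proof -
  have "prob {\<omega> \<in> space M. Y k \<omega> = y} = measure (distr M (count_space UNIV) (Y k)) {y}"
    using measurable_Y[OF k] by (simp add: measure_distr vimage_def Int_def conj_commute)
  also have "\<dots> = pmf (poisson_pmf (\<theta> k)) y"
    by (simp add: poisson_Y[OF k] measure_pmf_single)
  finally show ?thesis
    using rate_pos[OF k] by simp
qed

text \<open>The Poisson weight of \<open>y\<close> is multiplied by the binomial probability
  \<open>(1 - p j k) ^ y\<close> that all trials fail. The powers are merged so that the right side
  is a term of an exponential series in \<open>y\<close>.\<close>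

lemma prob_Z_0_Y_eq:
  assumes j: "j \<in> {1..d}" and k: "k \<in> {1..l}"
  shows "prob {\<omega> \<in> space M. Z j k \<omega> = 0 \<and> Y k \<omega> = y}
    = exp (- \<theta> k) * ((\<theta> k * (1 - p j k)) ^ y / fact y)"
proof -
  \<comment> \<open>Positivity allows clearing the denominator of the conditional
    probability.\<close>
  have "prob {\<omega> \<in> space M. Y k \<omega> = y} > 0"
    using rate_pos[OF k] by (simp add: prob_Y_eq[OF k])
  moreover have "\<P>(\<omega> in M. Z j k \<omega> = 0 \<bar> Y k \<omega> = y) = (1 - p j k) ^ y"
    using binomial_thinning[OF j k, of 0 y] by simp
  ultimately have "prob {\<omega> \<in> space M. Z j k \<omega> = 0 \<and> Y k \<omega> = y}
      = (1 - p j k) ^ y * prob {\<omega> \<in> space M. Y k \<omega> = y}"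
    by (simp add: cond_prob_def field_simps)
  then show ?thesis
    by (simp add: prob_Y_eq[OF k] power_mult_distrib)
qed

text \<open>The event is split by the value of \<open>Y k\<close>, and the resulting series is
  summed as an exponential series.\<close>

lemma prob_Z_0:
  assumes j: "j \<in> {1..d}" and k: "k \<in> {1..l}"
  shows "prob {\<omega> \<in> space M. Z j k \<omega> = 0} = exp (- (\<theta> k * p j k))"
proof -
  let ?A = "\<lambda>y. {\<omega> \<in> space M. Z j k \<omega> = 0 \<and> Y k \<omega> = y}"
  have "?A y \<in> events" for y
    using events_Z_eq[OF j k] events_Y_eq[OF k] by auto
  then have "(\<lambda>y. prob (?A y)) sums prob (\<Union>y. ?A y)"
    by (intro finite_measure_UNION) (auto simp: disjoint_family_on_def)
  also have "(\<Union>y. ?A y) = {\<omega> \<in> space M. Z j k \<omega> = 0}"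
    by auto
  finally have "(\<lambda>y. exp (- \<theta> k) * ((\<theta> k * (1 - p j k)) ^ y / fact y)) sums
      prob {\<omega> \<in> space M. Z j k \<omega> = 0}"
    by (simp add: prob_Z_0_Y_eq[OF j k])
  moreover have "(\<lambda>y. exp (- \<theta> k) * ((\<theta> k * (1 - p j k)) ^ y / fact y)) sums
      (exp (- \<theta> k) * exp (\<theta> k * (1 - p j k)))"
    using exp_converges[of "\<theta> k * (1 - p j k)"]
    by (intro sums_mult) (simp add: divide_inverse mult.commute)
  ultimately have "prob {\<omega> \<in> space M. Z j k \<omega> = 0} = exp (- \<theta> k) * exp (\<theta> k * (1 - p j k))"
    by (rule sums_unique2)
  also have "\<dots> = exp (- (\<theta> k * p j k))"
    by (simp add: exp_add[symmetric] algebra_simps)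
  finally show ?thesis .
qed

text \<open>Union bound: a sum of natural numbers is nonzero exactly when some summand is.\<close>

lemma prob_X_neq_0_le:
  assumes j: "j \<in> {1..d}"
  shows "prob {\<omega> \<in> space M. X j \<omega> \<noteq> 0} \<le> (\<Sum>k=1..l. 1 - exp (- (\<theta> k * p j k)))"
proof -
  have ev: "{\<omega> \<in> space M. Z j k \<omega> \<noteq> 0} \<in> events" if "k \<in> {1..l}" for k
    using events_Z_eq[OF j that] by (rule sets.sets_Collect_neg)
  have X_neq_0: "X j \<omega> \<noteq> 0 \<longleftrightarrow> (\<exists>k\<in>{1..l}. Z j k \<omega> \<noteq> 0)" if "\<omega> \<in> space M" for \<omega>
    by (simp add: X_eq[OF j that] sum_eq_0_iff del: neq0_conv)
  have "prob {\<omega> \<in> space M. X j \<omega> \<noteq> 0} = prob (\<Union>k\<in>{1..l}. {\<omega> \<in> space M. Z j k \<omega> \<noteq> 0})"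
    using X_neq_0 by (intro arg_cong[of _ _ prob]) blast
  also have "\<dots> \<le> (\<Sum>k=1..l. prob {\<omega> \<in> space M. Z j k \<omega> \<noteq> 0})"
    using ev by (intro finite_measure_subadditive_finite) auto
  also have "\<dots> = (\<Sum>k=1..l. 1 - exp (- (\<theta> k * p j k)))"
    \<comment> \<open>Removing \<open>neq0_conv\<close> keeps the event in negated form, as
      \<open>prob_neg\<close> requires.\<close>
    using events_Z_eq[OF j] by (intro sum.cong) (simp_all add: prob_neg prob_Z_0[OF j] del: neq0_conv)
  finally show ?thesis .
qed

section \<open>A positive lower bound independent of the thinning probabilities\<close>

lemma prob_all_Y_0: "prob {\<omega> \<in> space M. \<forall>k\<in>{1..l}. Y k \<omega> = 0} = exp (- (\<Sum>k=1..l. \<theta> k))"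
\<comment> \<open>For \<open>l = 0\<close> the intersection below would be the whole type instead of
  \<open>space M\<close>; that case is treated separately, with both sides equal to 1.\<close>
proof (cases "l = 0")
  case False
  have "prob (\<Inter>k\<in>{1..l}. Y k -` {0} \<inter> space M) = (\<Prod>k=1..l. prob (Y k -` {0} \<inter> space M))"
    using False by (intro indep_varsD[OF indep_Y]) auto
  also have "(\<Inter>k\<in>{1..l}. Y k -` {0} \<inter> space M) = {\<omega> \<in> space M. \<forall>k\<in>{1..l}. Y k \<omega> = 0}"
    using False by auto
  also have "(\<Prod>k=1..l. prob (Y k -` {0} \<inter> space M)) = (\<Prod>k=1..l. exp (- \<theta> k))"
    using prob_Y_eq[of _ 0] by (intro prod.cong) (simp_all add: vimage_def Int_def conj_commute)
  finally show ?thesis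
    by (simp add: exp_sum[symmetric] sum_negf)
qed (simp add: prob_space)

text \<open>If every background variable is 0, there is nothing to thin, so almost surely every
  component is 0 and hence at most \<open>x\<close>.\<close>

lemma prob_all_X_le_lower_bound:
  assumes J: "J \<subseteq> {1..d}"
  shows "prob {\<omega> \<in> space M. \<forall>j\<in>J. X j \<omega> \<le> x} \<ge> exp (- (\<Sum>k=1..l. \<theta> k))"
proof -
  \<comment> \<open>The model prescribes only laws, so the implication may fail on a null set. That
    set is null because the events \<open>Y k = 0\<close> and
    \<open>Z j k = 0 \<and> Y k = 0\<close> both have probability
    \<open>exp (- \<theta> k)\<close>.\<close>
  have Z_AE: "AE \<omega> in M. Y k \<omega> = 0 \<longrightarrow> Z j k \<omega> = 0" if j: "j \<in> {1..d}" and k: "k \<in> {1..l}" for j k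
  proof -
    have ev: "{\<omega> \<in> space M. Z j k \<omega> = 0 \<and> Y k \<omega> = 0} \<in> events"
      using events_Z_eq[OF j k] events_Y_eq[OF k] by auto
    have "prob ({\<omega> \<in> space M. Y k \<omega> = 0} - {\<omega> \<in> space M. Z j k \<omega> = 0 \<and> Y k \<omega> = 0}) = 0"
      using events_Y_eq[OF k] ev
      by (subst finite_measure_Diff) (auto simp: prob_Y_eq[OF k] prob_Z_0_Y_eq[OF j k])
    then show ?thesis
      using events_Y_eq[OF k] ev
      by (intro AE_I[where N = "{\<omega> \<in> space M. Y k \<omega> = 0} - {\<omega> \<in> space M. Z j k \<omega> = 0 \<and> Y k \<omega> = 0}"])
        (auto simp: emeasure_eq_measure)
  qed
  have "AE \<omega> in M. \<forall>j\<in>{1..d}. \<forall>k\<in>{1..l}. Y k \<omega> = 0 \<longrightarrow> Z j k \<omega> = 0"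
    using Z_AE by (intro AE_finite_allI) auto
  then have "AE \<omega> in M. \<omega> \<in> {\<omega> \<in> space M. \<forall>k\<in>{1..l}. Y k \<omega> = 0} \<longrightarrow>
      \<omega> \<in> {\<omega> \<in> space M. \<forall>j\<in>J. X j \<omega> \<le> x}"
  proof eventually_elim
    case (elim \<omega>)
    then show ?case
      using J X_eq[of _ \<omega>] by (auto simp: subset_iff)
  qed
  then show ?thesis
    unfolding prob_all_Y_0[symmetric] by (intro finite_measure_mono_AE events_all_X_le J)
qed

section \<open>Bounds for the distribution functions of the maximum and minimum\<close>

lemma cdf_max_comp:
  assumes "d \<ge> 1"
  shows "cdf_of M (max_comp d X) (real x) = prob {\<omega> \<in> space M. \<forall>j\<in>{1..d}. X j \<omega> \<le> x}"
  by (subst cdf_of_eq_prob) (use events_all_X_le in \<open>simp_all only: max_comp_le_iff[OF assms] order_refl\<close>)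

lemma cdf_min_comp:
  assumes "d \<ge> 1"
  shows "cdf_of M (min_comp d X) (real x) = prob {\<omega> \<in> space M. \<exists>j\<in>{1..d}. X j \<omega> \<le> x}"
  by (subst cdf_of_eq_prob) (use events_ex_X_le in \<open>simp_all only: min_comp_le_iff[OF assms] order_refl\<close>)

lemma cdf_max_comp_except:
  "cdf_of M (max_comp_except d i X) (real x) = prob {\<omega> \<in> space M. \<forall>j\<in>{1..d} - {i}. X j \<omega> \<le> x}"
  by (subst cdf_of_eq_prob) (use events_all_X_le in \<open>simp_all only: max_comp_except_le_iff Diff_subset\<close>)

lemma cdf_max_comp_bounds:
  assumes i: "i \<in> {1..d}"
  shows "cdf_of M (max_comp d X) (real x) \<le> cdf_of M (max_comp_except d i X) (real x)"
    and "cdf_of M (max_comp_except d i X) (real x)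
      \<le> cdf_of M (max_comp d X) (real x) + (\<Sum>k=1..l. 1 - exp (- (\<theta> k * p i k)))"
proof -
  let ?A = "{\<omega> \<in> space M. \<forall>j\<in>{1..d}. X j \<omega> \<le> x}"
  let ?B = "{\<omega> \<in> space M. \<forall>j\<in>{1..d} - {i}. X j \<omega> \<le> x}"
  let ?N = "{\<omega> \<in> space M. X i \<omega> \<noteq> 0}"
  have d: "d \<ge> 1"
    using i by simp
  have A: "?A \<in> events" and B: "?B \<in> events"
    by (auto intro!: events_all_X_le)
  have N: "?N \<in> events"
    using sets.compl_sets[OF events_X_le[OF i, of 0]] by (simp add: set_diff_eq cong: conj_cong)
  show "cdf_of M (max_comp d X) (real x) \<le> cdf_of M (max_comp_except d i X) (real x)"
    unfolding cdf_max_comp[OF d] cdf_max_comp_except using B by (intro finite_measure_mono) auto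
  \<comment> \<open>Outside \<open>?N\<close> the component \<open>X i\<close> is 0, so the
    constraint on it that \<open>?B\<close> omits holds automatically.\<close>
  have "prob ?B \<le> prob (?A \<union> ?N)"
  proof (intro finite_measure_mono subsetI)
    fix \<omega> assume "\<omega> \<in> ?B"
    then show "\<omega> \<in> ?A \<union> ?N"
      by (cases "X i \<omega> = 0") force+
  qed (use A N in auto)
  also have "\<dots> \<le> prob ?A + prob ?N"
    using A N by (rule measure_Un_le)
  also have "prob ?N \<le> (\<Sum>k=1..l. 1 - exp (- (\<theta> k * p i k)))"
    by (rule prob_X_neq_0_le[OF i])
  finally show "cdf_of M (max_comp_except d i X) (real x)
      \<le> cdf_of M (max_comp d X) (real x) + (\<Sum>k=1..l. 1 - exp (- (\<theta> k * p i k)))"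
    unfolding cdf_max_comp[OF d] cdf_max_comp_except by simp
qed

lemma cdf_max_comp_except_lower_bound:
  "cdf_of M (max_comp_except d i X) (real x) \<ge> exp (- (\<Sum>k=1..l. \<theta> k))"
  unfolding cdf_max_comp_except by (rule prob_all_X_le_lower_bound) auto

lemma cdf_min_comp_bounds:
  assumes i: "i \<in> {1..d}"
  shows "cdf_of M (min_comp d X) (real x) \<le> 1"
    and "cdf_of M (min_comp d X) (real x) \<ge> 1 - (\<Sum>k=1..l. 1 - exp (- (\<theta> k * p i k)))"
proof -
  have d: "d \<ge> 1"
    using i by simp
  have ev: "{\<omega> \<in> space M. X i \<omega> = 0} \<in> events"
    using events_X_le[OF i, of 0] by simp
  show "cdf_of M (min_comp d X) (real x) \<le> 1"
    unfolding cdf_min_comp[OF d] by simp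
  have "1 - (\<Sum>k=1..l. 1 - exp (- (\<theta> k * p i k))) \<le> 1 - prob {\<omega> \<in> space M. X i \<omega> \<noteq> 0}"
    using prob_X_neq_0_le[OF i] by simp
  also have "\<dots> = prob {\<omega> \<in> space M. X i \<omega> = 0}"
    using ev by (simp add: prob_neg del: neq0_conv)
  \<comment> \<open>Index \<open>i\<close> itself is the witness: its component is 0, hence at most
    \<open>x\<close>.\<close>
  also have "\<dots> \<le> prob {\<omega> \<in> space M. \<exists>j\<in>{1..d}. X j \<omega> \<le> x}"
    by (intro finite_measure_mono events_ex_X_le) (use i in \<open>auto intro!: bexI[of _ i]\<close>)
  finally show "cdf_of M (min_comp d X) (real x) \<ge> 1 - (\<Sum>k=1..l. 1 - exp (- (\<theta> k * p i k)))"
    unfolding cdf_min_comp[OF d] .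
qed

end

section \<open>Passage to the limit\<close>

lemma asymp_equiv_if_diff_tendsto_0:
  fixes f g e :: "'n \<Rightarrow> real"
  assumes e: "(e \<longlongrightarrow> 0) F" and c: "c > 0"
    and lower: "\<forall>\<^sub>F n in F. c \<le> g n"
    and diff: "\<forall>\<^sub>F n in F. \<bar>f n - g n\<bar> \<le> e n"
  shows "f \<sim>[F] g"
proof (rule asymp_equivI')
  have "((\<lambda>n. f n / g n - 1) \<longlongrightarrow> 0) F"
  proof (rule Lim_null_comparison)
    show "((\<lambda>n. e n / c) \<longlongrightarrow> 0) F"
      using tendsto_divide[OF e tendsto_const[of c]] c by simp
    \<comment> \<open>Keeping \<open>g\<close> above \<open>c\<close> turns the absolute error into
      a relative one: the distance of the ratio from 1 is
      \<open>\<bar>f n - g n\<bar> / g n\<close>, at most \<open>e n / c\<close>.\<close>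
    show "\<forall>\<^sub>F n in F. norm (f n / g n - 1) \<le> e n / c"
      using lower diff
    proof eventually_elim
      case (elim n)
      then have "f n / g n - 1 = (f n - g n) / g n" and "\<bar>g n\<bar> = g n"
        using c by (auto simp: field_simps)
      moreover have "\<bar>f n - g n\<bar> / g n \<le> e n / c"
        using elim c by (intro frac_le) auto
      ultimately show ?case
        by (simp add: abs_divide)
    qed
  qed
  then show "((\<lambda>n. f n / g n) \<longlongrightarrow> 1) F"
    by (simp add: LIM_zero_iff)
qed

text \<open>The parameter limit runs along an arbitrary filter. \<open>p(i := q n)\<close> changes
  only the row of component \<open>i\<close>, while the probability space and the random variables
  may vary with \<open>n\<close>, since their joint law depends on that row.\<close>

theorem proposition4p9:
  fixes F :: "'n filter"
    and M :: "'n \<Rightarrow> 'a measure"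
    and d l i :: nat
    and \<theta> :: "nat \<Rightarrow> real"
    and p :: "nat \<Rightarrow> nat \<Rightarrow> real"
    and q :: "'n \<Rightarrow> nat \<Rightarrow> real"
    and Y :: "'n \<Rightarrow> nat \<Rightarrow> 'a \<Rightarrow> nat"
    and Z :: "'n \<Rightarrow> nat \<Rightarrow> nat \<Rightarrow> 'a \<Rightarrow> nat"
    and X :: "'n \<Rightarrow> nat \<Rightarrow> 'a \<Rightarrow> nat"
    and x :: nat
  assumes "i \<in> {1..d}"
    and "\<forall>\<^sub>F n in F. thinning_dependence_poisson (M n) d l \<theta> (p(i := q n)) (Y n) (Z n) (X n)"
    and "\<forall>k\<in>{1..l}. ((\<lambda>n. q n k) \<longlongrightarrow> 0) F"
  shows "(\<lambda>n. cdf_of (M n) (max_comp d (X n)) (real x))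
           \<sim>[F] (\<lambda>n. cdf_of (M n) (max_comp_except d i (X n)) (real x))
       \<and> (\<lambda>n. cdf_of (M n) (min_comp d (X n)) (real x)) \<sim>[F] (\<lambda>_. 1)"
proof
  \<comment> \<open>This is the union bound for \<open>X i \<noteq> 0\<close> with row
    \<open>i\<close> set to \<open>q n\<close>. It controls the errors of both claims and tends to 0
    by continuity of the exponential.\<close>
  define e where "e n = (\<Sum>k=1..l. 1 - exp (- (\<theta> k * q n k)))" for n
  have "(e \<longlongrightarrow> (\<Sum>k=1..l. 1 - exp (- (\<theta> k * 0)))) F"
    unfolding e_def using assms(3) by (intro tendsto_intros) auto
  then have e: "(e \<longlongrightarrow> 0) F"
    by simp
  have "\<forall>\<^sub>F n in F. exp (- (\<Sum>k=1..l. \<theta> k)) \<le> cdf_of (M n) (max_comp_except d i (X n)) (real x)"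
    using assms(2)
    by eventually_elim (rule thinning_dependence_poisson.cdf_max_comp_except_lower_bound)
  moreover have "\<forall>\<^sub>F n in F. \<bar>cdf_of (M n) (max_comp d (X n)) (real x)
      - cdf_of (M n) (max_comp_except d i (X n)) (real x)\<bar> \<le> e n"
    using assms(2)
  proof eventually_elim
    case (elim n)
    from thinning_dependence_poisson.cdf_max_comp_bounds[OF elim assms(1), of x]
    show ?case
      by (simp add: e_def)
  qed
  ultimately show "(\<lambda>n. cdf_of (M n) (max_comp d (X n)) (real x))
      \<sim>[F] (\<lambda>n. cdf_of (M n) (max_comp_except d i (X n)) (real x))"
    by (intro asymp_equiv_if_diff_tendsto_0[OF e exp_gt_zero])
  \<comment> \<open>Here the comparison function is constantly 1, so \<open>c = 1\<close> serves as
    its lower bound.\<close>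
  have "\<forall>\<^sub>F n in F. \<bar>cdf_of (M n) (min_comp d (X n)) (real x) - 1\<bar> \<le> e n"
    using assms(2)
  proof eventually_elim
    case (elim n)
    from thinning_dependence_poisson.cdf_min_comp_bounds[OF elim assms(1), of x]
    show ?case
      by (simp add: e_def)
  qed
  then show "(\<lambda>n. cdf_of (M n) (min_comp d (X n)) (real x)) \<sim>[F] (\<lambda>_. 1)"
    by (intro asymp_equiv_if_diff_tendsto_0[OF e zero_less_one]) auto
qed

end
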